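(* The generating function $S(x)$ in which the coefficient of $x^n$ is the total number of partial packing paths with $n$ steps satisfies $$S(x)=\frac{1-x-2x^2-\sqrt{1-2x+x^2-4x^3+4x^4}}{2x^2(-1+2x)}.$$ As $n\to\infty$, $[x^n]S(x)\sim\dfrac{2^{n+1}}{\sqrt{\pi n}}$.
   Context: Consider the hexagonal packing of the plane by circles of radius $2$ with centers $(2+4i+2j,\,2\sqrt3\,j)$, $i,j\in\mathbb Z$; the origin is the tangency point of two horizontally adjacent circles. The tangency points cut every circle into six arcs. Traversed from left to right these give six types of steps (angles measured on the circle carrying the arc): $U$ from $180^\circ$ to $120^\circ$ (displacement $(1,\sqrt3)$), $F$ from $120^\circ$ to $60^\circ$ (displacement $(2,0)$), $D$ from $60^\circ$ to $0^\circ$ (displacement $(1,-\sqrt3)$), $\overline U$ from $300^\circ$ to $360^\circ$ (displacement $(1,\sqrt3)$), $\overline F$ from $240^\circ$ to $300^\circ$ (displacement $(2,0)$), $\overline D$ from $180^\circ$ to $240^\circ$ (displacement $(1,-\sqrt3)$). A path in the packing starts at the origin, is a concatenation of such arcs of circles of the packing, each starting where the previous one ends, and stays in the quarter plane $x,y\ge 0$. Equivalently, it is a word in $\{U,F,D,\overline U,\overline F,\overline D\}$ whose first step (if any) is $U$, in which $U$ or $\overline F$ can only be followed by $F$ or $\overline U$; $F$ or $\overline D$ only by $\overline F$ or $D$; $\overline U$ or $D$ only by $U$ or $\overline D$; and which never goes below ordinate $0$. A packing path is such a path ending on the $x$-axis; a partial packing path is any prefix of a packing path. The empty path is allowed. The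 number of steps of a path is its number of arcs. The square root is the formal power series with constant term $1$; $a_n\sim b_n$ means $a_n/b_n\to1$. *)

theory Defs
  imports
    Complex_Main
    "HOL-Library.Sublist"
    "HOL-Library.Landau_Symbols"
    "HOL-Computational_Algebra.Formal_Laurent_Series"
begin

text \<open>The plane is identified with \<^typ>\<open>complex\<close>; all circles have radius 2.\<close>

definition circle_centre :: "int \<Rightarrow> int \<Rightarrow> complex" where
  "circle_centre i j = Complex (2 + 4 * of_int i + 2 * of_int j) (2 * sqrt 3 * of_int j)"

datatype step = U | F | D | Ubar | Fbar | Dbar

primrec start_angle :: "step \<Rightarrow> real" where
  "start_angle U = pi"
| "start_angle F = 2 * pi / 3"
| "start_angle D = pi / 3"
| "start_angle Ubar = 5 * pi / 3"
| "start_angle Fbar = 4 * pi / 3"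
| "start_angle Dbar = pi"

primrec end_angle :: "step \<Rightarrow> real" where
  "end_angle U = 2 * pi / 3"
| "end_angle F = pi / 3"
| "end_angle D = 0"
| "end_angle Ubar = 2 * pi"
| "end_angle Fbar = 5 * pi / 3"
| "end_angle Dbar = 4 * pi / 3"

text \<open>An arc is encoded as \<open>(i, j, s)\<close>: the sixth of type \<open>s\<close> of the circle with
  centre \<open>circle_centre i j\<close>, traversed from left to right.\<close>

type_synonym packing_arc = "int \<times> int \<times> step"

fun arc_start :: "packing_arc \<Rightarrow> complex" where
  "arc_start (i, j, s) = circle_centre i j + 2 * cis (start_angle s)"

fun arc_end :: "packing_arc \<Rightarrow> complex" where
  "arc_end (i, j, s) = circle_centre i j + 2 * cis (end_angle s)"

fun arc_points :: "packing_arc \<Rightarrow> complex set" where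
  "arc_points (i, j, s) = (\<lambda>t. circle_centre i j + 2 * cis t) `
     {min (start_angle s) (end_angle s)..max (start_angle s) (end_angle s)}"

definition quarter_plane :: "complex set" where
  "quarter_plane = {z. 0 \<le> Re z \<and> 0 \<le> Im z}"

definition path_in_packing :: "packing_arc list \<Rightarrow> bool" where
  "path_in_packing p \<longleftrightarrow>
     (p \<noteq> [] \<longrightarrow> arc_start (hd p) = 0) \<and>
     successively (\<lambda>a b. arc_end a = arc_start b) p \<and>
     (\<forall>a\<in>set p. arc_points a \<subseteq> quarter_plane)"

definition endpoint :: "packing_arc list \<Rightarrow> complex" where
  "endpoint p = (if p = [] then 0 else arc_end (last p))"

definition packing_path :: "packing_arc list \<Rightarrow> bool" where
  "packing_path p \<longleftrightarrow> path_in_packing p \<and> Im (endpoint p) = 0"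

definition partial_packing_path :: "packing_arc list \<Rightarrow> bool" where
  "partial_packing_path p \<longleftrightarrow> (\<exists>q. packing_path q \<and> prefix p q)"

text \<open>The denominator of the closed form is not a unit in \<^typ>\<open>real fps\<close>, where division by
  such a series truncates; the quotient is therefore to be taken in the field
  \<^typ>\<open>real fls\<close>, where it is exact.\<close>

definition S :: "real fps" where
  "S = Abs_fps (\<lambda>n. real (card {p. partial_packing_path p \<and> length p = n}))"

text \<open>As \<open>root 2 1 = 1\<close>, for a series with constant term 1 this is the square root with
  constant term 1.\<close>

definition fps_sqrt :: "real fps \<Rightarrow> real fps" where
  "fps_sqrt f = fps_radical root 2 f"

end

(*
  Adjacent to every node (tangency point) are exactly two outgoing arcs, and staying in the quarter
  plane only excludes the downward arc at ordinate 0. A partial packing path is any walk, because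
  every walk can be continued down to the axis. Let t, H, K be the generating functions of the
  first passages that lower the height by one from nodes of the three kinds,
      t = x + x K t,   H = x + x K,   K = x H (1 + t),
  and W = 1/(1 - 2x) that of all unrestricted walks. The walks that eventually leave the half plane
  decompose into first passages, so from height 2j there are W (1 - t (t H)^j) walks that stay. This
  is verified by checking that these series solve the linear recursions for the counts; for j = 0
  it gives S = W (1 - t), and t is quadratic over Q(x).

  For the asymptotics, 1 + x + 2 x^2 S = (1 - 2x)^(-1/2) (1 + x^2 - 2 x^3)^(1/2). The second
  factor has radius of convergence greater than 1/2 and value 1 at 1/2, so by Tannery's theorem the
  coefficients of the product are asymptotic to those of the first factor, i.e. to 2^n/sqrt(pi n).
*)
theory Submission
  imports Defs "HOL-Analysis.Analysis" "HOL-Real_Asymp.Real_Asymp"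
begin

unbundle no vec_syntax
unbundle fps_syntax

subsection \<open>The graph of arcs\<close>

text \<open>Every tangency point has an integer abscissa and an ordinate that is an integer multiple
  of sqrt 3, so in these coordinates equality of points becomes integer arithmetic.\<close>

definition grid :: "int \<Rightarrow> int \<Rightarrow> complex" where
  "grid x y = Complex (of_int x) (sqrt 3 * of_int y)"

lemma grid_eq_iff [simp]: "grid x y = grid x' y' \<longleftrightarrow> x = x' \<and> y = y'"
  by (simp add: grid_def)

lemma Re_grid [simp]: "Re (grid x y) = of_int x"
  and Im_grid [simp]: "Im (grid x y) = sqrt 3 * of_int y"
  by (simp_all add: grid_def)

lemma cos_240: "cos (4 * pi / 3) = - (1 / 2)" and sin_240: "sin (4 * pi / 3) = - (sqrt 3 / 2)"
proof -
  have "4 * pi / 3 = pi / 3 + pi" by simp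
  then show "cos (4 * pi / 3) = - (1 / 2)" "sin (4 * pi / 3) = - (sqrt 3 / 2)"
    by (simp_all only: cos_periodic_pi sin_periodic_pi cos_60 sin_60)
qed

lemma cos_300: "cos (5 * pi / 3) = 1 / 2" and sin_300: "sin (5 * pi / 3) = - (sqrt 3 / 2)"
proof -
  have "5 * pi / 3 = 2 * pi - pi / 3" by simp
  then show "cos (5 * pi / 3) = 1 / 2" "sin (5 * pi / 3) = - (sqrt 3 / 2)"
    by (simp_all only: cos_2pi_minus sin_2pi_minus cos_60 sin_60)
qed

lemmas cos_sin_values = cos_60 sin_60 cos_120 sin_120 cos_240 sin_240 cos_300 sin_300

lemma arc_start_grid:
  "arc_start (i, j, U) = grid (4 * i + 2 * j) (2 * j)"
  "arc_start (i, j, F) = grid (4 * i + 2 * j + 1) (2 * j + 1)"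
  "arc_start (i, j, D) = grid (4 * i + 2 * j + 3) (2 * j + 1)"
  "arc_start (i, j, Ubar) = grid (4 * i + 2 * j + 3) (2 * j - 1)"
  "arc_start (i, j, Fbar) = grid (4 * i + 2 * j + 1) (2 * j - 1)"
  "arc_start (i, j, Dbar) = grid (4 * i + 2 * j) (2 * j)"
  by (simp_all add: complex_eq_iff circle_centre_def cos_sin_values distrib_left right_diff_distrib)

lemma arc_end_grid:
  "arc_end (i, j, U) = grid (4 * i + 2 * j + 1) (2 * j + 1)"
  "arc_end (i, j, F) = grid (4 * i + 2 * j + 3) (2 * j + 1)"
  "arc_end (i, j, D) = grid (4 * i + 2 * j + 4) (2 * j)"
  "arc_end (i, j, Ubar) = grid (4 * i + 2 * j + 4) (2 * j)"
  "arc_end (i, j, Fbar) = grid (4 * i + 2 * j + 3) (2 * j - 1)"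
  "arc_end (i, j, Dbar) = grid (4 * i + 2 * j + 1) (2 * j - 1)"
  by (simp_all add: complex_eq_iff circle_centre_def cos_sin_values distrib_left right_diff_distrib)

lemma arc_end_mem: "arc_end a \<in> arc_points a"
  by (cases a rule: arc_end.cases) auto

text \<open>The cosine is monotone on \<open>[0, \<pi>]\<close> and on \<open>[\<pi>, 2\<pi>]\<close>, each arc lies in one of the
  two half circles, and it is traversed from left to right.\<close>

lemma Re_arc_points:
  assumes "z \<in> arc_points (i, j, s)"
  shows "Re (arc_start (i, j, s)) \<le> Re z"
proof -
  obtain t where t: "z = circle_centre i j + 2 * cis t"
    "min (start_angle s) (end_angle s) \<le> t" "t \<le> max (start_angle s) (end_angle s)"
    using assms by auto
  have "cos (start_angle s) \<le> cos t"
  proof (cases "s \<in> {U, F, D}")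
    case True
    then show ?thesis using t(2,3) by (intro cos_monotone_0_pi_le) auto
  next
    case False
    \<comment> \<open>Reflecting t to 2 pi - t carries the lower half circle to [0, pi].\<close>
    then have "cos (2 * pi - start_angle s) \<le> cos (2 * pi - t)"
      using t(2,3) by (cases s) (intro cos_monotone_0_pi_le; auto)+
    then show ?thesis by (simp only: cos_2pi_minus)
  qed
  then show ?thesis using t(1) by simp
qed

text \<open>On upper arcs the sine is nonnegative. For lower arcs the centre has height at least 2
  sqrt 3, more than the radius, so the whole circle lies above the axis.\<close>

lemma arc_points_above:
  assumes "z \<in> arc_points (i, j, s)" "0 \<le> j" "s \<in> {Ubar, Fbar, Dbar} \<longrightarrow> 1 \<le> j"
  shows "0 \<le> Im z"
proof -
  obtain t where t: "z = circle_centre i j + 2 * cis t"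
    "min (start_angle s) (end_angle s) \<le> t" "t \<le> max (start_angle s) (end_angle s)"
    using assms(1) by auto
  have "0 \<le> sqrt 3 * of_int j + sin t"
  proof (cases "s \<in> {U, F, D}")
    case True
    then have "0 \<le> sin t" using t(2,3) by (intro sin_ge_zero) auto
    then show ?thesis using assms(2) by simp
  next
    case False
    then have "1 \<le> (of_int j :: real)" using assms(3) by (cases s) auto
    then have "1 * 1 \<le> sqrt 3 * of_int j" by (intro mult_mono) auto
    then show ?thesis using sin_ge_minus_one[of t] by linarith
  qed
  then show ?thesis using t(1) by (simp add: circle_centre_def)
qed

lemma arc_points_quarter_plane:
  assumes "0 \<le> Re (arc_start (i, j, s))" "0 \<le> j" "s \<in> {Ubar, Fbar, Dbar} \<longrightarrow> 1 \<le> j"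
  shows "arc_points (i, j, s) \<subseteq> quarter_plane"
proof
  fix z
  assume z: "z \<in> arc_points (i, j, s)"
  have "0 \<le> Re z" using Re_arc_points[OF z] assms(1) by linarith
  moreover have "0 \<le> Im z" using arc_points_above[OF z assms(2,3)] .
  ultimately show "z \<in> quarter_plane" by (simp add: quarter_plane_def)
qed

declare arc_start.simps [simp del] arc_end.simps [simp del] arc_points.simps [simp del]

section \<open>Outgoing arcs at the three kinds of nodes\<close>

definition arcs_from :: "complex \<Rightarrow> packing_arc set" where
  "arcs_from z = {a. arc_start a = z \<and> arc_points a \<subseteq> quarter_plane}"

text \<open>The node is the leftmost point of circle (i, j), and both candidate arcs lie on that
  circle.\<close>

lemma arcs_from_A:
  assumes "0 \<le> 2 * i + j" "0 \<le> j"
  shows "arcs_from (grid (4 * i + 2 * j) (2 * j)) =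
           {(i, j, U)} \<union> (if j = 0 then {} else {(i, j, Dbar)})" (is "_ = ?R")
proof (intro set_eqI iffI)
  fix a :: packing_arc
  assume a: "a \<in> arcs_from (grid (4 * i + 2 * j) (2 * j))"
  obtain i' j' s where [simp]: "a = (i', j', s)" by (cases a)
  have "arc_start (i', j', s) = grid (4 * i + 2 * j) (2 * j)"
    using a by (simp only: arcs_from_def mem_Collect_eq \<open>a = _\<close>)
  \<comment> \<open>The parity of y and the residue of x - y modulo 4 determine which two types of
    arcs start at \<open>grid x y\<close>; the indices then follow.\<close>
  then have eq: "i' = i \<and> j' = j \<and> (s = U \<or> s = Dbar)"
    by (cases s) (simp_all only: arc_start_grid grid_eq_iff step.distinct simp_thms, presburger+)
  moreover have "j \<noteq> 0" if "s = Dbar"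
  proof
    assume "j = 0"
    \<comment> \<open>For j = 0 this arc would end at height -1 in units of sqrt 3.\<close>
    then have "arc_end (i, 0, Dbar) \<in> quarter_plane"
      using eq a that arc_end_mem[of a] by (auto simp: arcs_from_def)
    then show False
      by (simp only: arc_end_grid quarter_plane_def mem_Collect_eq Re_grid Im_grid) simp
  qed
  ultimately show "a \<in> ?R" by auto
next
  fix a :: packing_arc
  assume "a \<in> ?R"
  then have "a = (i, j, U) \<or> (a = (i, j, Dbar) \<and> 1 \<le> j)"
    using assms by (auto split: if_splits)
  then show "a \<in> arcs_from (grid (4 * i + 2 * j) (2 * j))"
    unfolding arcs_from_def mem_Collect_eq
    using assms arc_points_quarter_plane[of i j U] arc_points_quarter_plane[of i j Dbar]
    by (elim disjE conjE) (simp_all add: arc_start_grid)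
qed

text \<open>The node lies at 120 degrees on circle (i, j) and at 300 degrees on its upper left
  neighbour (i - 1, j + 1); each of them contributes one arc.\<close>

lemma arcs_from_B:
  assumes "0 \<le> 2 * i + j" "0 \<le> j"
  shows "arcs_from (grid (4 * i + 2 * j + 1) (2 * j + 1)) = {(i, j, F), (i - 1, j + 1, Ubar)}"
    (is "_ = ?R")
proof (intro set_eqI iffI)
  fix a :: packing_arc
  assume a: "a \<in> arcs_from (grid (4 * i + 2 * j + 1) (2 * j + 1))"
  obtain i' j' s where [simp]: "a = (i', j', s)" by (cases a)
  have "arc_start (i', j', s) = grid (4 * i + 2 * j + 1) (2 * j + 1)"
    using a by (simp only: arcs_from_def mem_Collect_eq \<open>a = _\<close>)
  then have "(s = F \<and> i' = i \<and> j' = j) \<or> (s = Ubar \<and> i' = i - 1 \<and> j' = j + 1)"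
    by (cases s) (simp_all only: arc_start_grid grid_eq_iff step.distinct simp_thms, presburger+)
  then show "a \<in> ?R" by auto
next
  fix a :: packing_arc
  assume "a \<in> ?R"
  then have "a = (i, j, F) \<or> a = (i - 1, j + 1, Ubar)" by simp
  then show "a \<in> arcs_from (grid (4 * i + 2 * j + 1) (2 * j + 1))"
    unfolding arcs_from_def mem_Collect_eq
    using assms arc_points_quarter_plane[of i j F] arc_points_quarter_plane[of "i - 1" "j + 1" Ubar]
    by (elim disjE) (simp_all add: arc_start_grid algebra_simps)
qed

text \<open>The node lies at 60 degrees on circle (i, j) and at 240 degrees on its upper right
  neighbour (i, j + 1).\<close>

lemma arcs_from_C:
  assumes "-1 \<le> 2 * i + j" "0 \<le> j"
  shows "arcs_from (grid (4 * i + 2 * j + 3) (2 * j + 1)) = {(i, j, D), (i, j + 1, Fbar)}"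
    (is "_ = ?R")
proof (intro set_eqI iffI)
  fix a :: packing_arc
  assume a: "a \<in> arcs_from (grid (4 * i + 2 * j + 3) (2 * j + 1))"
  obtain i' j' s where [simp]: "a = (i', j', s)" by (cases a)
  have "arc_start (i', j', s) = grid (4 * i + 2 * j + 3) (2 * j + 1)"
    using a by (simp only: arcs_from_def mem_Collect_eq \<open>a = _\<close>)
  then have "(s = D \<and> i' = i \<and> j' = j) \<or> (s = Fbar \<and> i' = i \<and> j' = j + 1)"
    by (cases s) (simp_all only: arc_start_grid grid_eq_iff step.distinct simp_thms, presburger+)
  then show "a \<in> ?R" by auto
next
  fix a :: packing_arc
  assume "a \<in> ?R"
  then have "a = (i, j, D) \<or> a = (i, j + 1, Fbar)" by simp
  then show "a \<in> arcs_from (grid (4 * i + 2 * j + 3) (2 * j + 1))"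
    unfolding arcs_from_def mem_Collect_eq
    using assms arc_points_quarter_plane[of i j D] arc_points_quarter_plane[of i "j + 1" Fbar]
    by (elim disjE) (simp_all add: arc_start_grid algebra_simps)
qed

section \<open>Walks and their continuation to the axis\<close>

primrec walk :: "complex \<Rightarrow> packing_arc list \<Rightarrow> bool" where
  "walk z [] \<longleftrightarrow> True"
| "walk z (a # p) \<longleftrightarrow> a \<in> arcs_from z \<and> walk (arc_end a) p"

primrec walk_end :: "complex \<Rightarrow> packing_arc list \<Rightarrow> complex" where
  "walk_end z [] = z"
| "walk_end z (a # p) = walk_end (arc_end a) p"

lemma walk_iff:
  "walk z p \<longleftrightarrow> (p \<noteq> [] \<longrightarrow> arc_start (hd p) = z) \<and>
     successively (\<lambda>a b. arc_end a = arc_start b) p \<and> (\<forall>a\<in>set p. arc_points a \<subseteq> quarter_plane)"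
  by (induction p arbitrary: z) (auto simp: arcs_from_def successively_Cons)

lemma path_in_packing_iff_walk: "path_in_packing p \<longleftrightarrow> walk 0 p"
  by (simp add: path_in_packing_def walk_iff)

lemma walk_end_conv_last: "walk_end z p = (if p = [] then z else arc_end (last p))"
  by (induction p arbitrary: z) auto

lemma walk_append: "walk z (p @ q) \<longleftrightarrow> walk z p \<and> walk (walk_end z p) q"
  by (induction p arbitrary: z) auto

lemma walk_end_append: "walk_end z (p @ q) = walk_end (walk_end z p) q"
  by (induction p arbitrary: z) auto

text \<open>Here and in the next two lemmas the end points are put into the normal forms of the
  three kinds of nodes, with shifted indices, so that introduction rules and induction hypotheses
  match them.\<close>

lemma arc_end_A:
  "arc_end (i, j, U) = grid (4 * i + 2 * j + 1) (2 * j + 1)"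
  "arc_end (i, j, Dbar) = grid (4 * i + 2 * (j - 1) + 3) (2 * (j - 1) + 1)"
  by (simp_all only: arc_end_grid) (simp_all add: algebra_simps)

lemma arc_end_B:
  "arc_end (i, j, F) = grid (4 * i + 2 * j + 3) (2 * j + 1)"
  "arc_end (i - 1, j + 1, Ubar) = grid (4 * i + 2 * (j + 1)) (2 * (j + 1))"
  by (simp_all only: arc_end_grid) (simp_all add: algebra_simps)

lemma arc_end_C:
  "arc_end (i, j, D) = grid (4 * (i + 1) + 2 * j) (2 * j)"
  "arc_end (i, j + 1, Fbar) = grid (4 * (i + 1) + 2 * j + 1) (2 * j + 1)"
  by (simp_all only: arc_end_grid) (simp_all add: algebra_simps)

text \<open>The bounds express that both coordinates are nonnegative: by integrality, 4i + 2j + 3 is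
  nonnegative exactly when -1 \<le> 2i + j.\<close>

inductive node :: "complex \<Rightarrow> bool" where
  node_A: "0 \<le> 2 * i + j \<Longrightarrow> 0 \<le> j \<Longrightarrow> node (grid (4 * i + 2 * j) (2 * j))"
| node_B: "0 \<le> 2 * i + j \<Longrightarrow> 0 \<le> j \<Longrightarrow> node (grid (4 * i + 2 * j + 1) (2 * j + 1))"
| node_C: "-1 \<le> 2 * i + j \<Longrightarrow> 0 \<le> j \<Longrightarrow> node (grid (4 * i + 2 * j + 3) (2 * j + 1))"

lemma node_arc_end:
  assumes "node z" "a \<in> arcs_from z"
  shows "node (arc_end a)"
  using assms(1)
proof cases
  case (node_A i j)
  then have "a = (i, j, U) \<or> (a = (i, j, Dbar) \<and> 1 \<le> j)"
    using assms(2) by (auto simp: arcs_from_A split: if_splits)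
  then show ?thesis
    using node_A(2,3) by (elim disjE conjE; simp only: arc_end_A; intro node.intros; simp)
next
  case (node_B i j)
  then have "a = (i, j, F) \<or> a = (i - 1, j + 1, Ubar)"
    using assms(2) by (auto simp: arcs_from_B)
  then show ?thesis
    using node_B(2,3) by (elim disjE; simp only: arc_end_B; intro node.intros; simp)
next
  case (node_C i j)
  then have "a = (i, j, D) \<or> a = (i, j + 1, Fbar)"
    using assms(2) by (auto simp: arcs_from_C)
  then show ?thesis
    using node_C(2,3) by (elim disjE; simp only: arc_end_C; intro node.intros; simp)
qed

lemma node_walk_end: "node z \<Longrightarrow> walk z p \<Longrightarrow> node (walk_end z p)"
  by (induction p arbitrary: z) (auto intro: node_arc_end)

text \<open>\<open>Dbar\<close> followed by \<open>D\<close> leads from the node with indices i, m +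
  1 to the node of the same kind with indices i + 1, m.\<close>

lemma walk_down_A:
  assumes "0 \<le> 2 * i + int m"
  shows "\<exists>q. walk (grid (4 * i + 2 * int m) (2 * int m)) q \<and>
             Im (walk_end (grid (4 * i + 2 * int m) (2 * int m)) q) = 0"
  using assms
proof (induction m arbitrary: i)
  case 0
  show ?case by (intro exI[of _ "[]"]) simp
next
  case (Suc m)
  obtain q where q: "walk (grid (4 * (i + 1) + 2 * int m) (2 * int m)) q"
    "Im (walk_end (grid (4 * (i + 1) + 2 * int m) (2 * int m)) q) = 0"
    using Suc.IH[of "i + 1"] Suc.prems by auto
  let ?a = "(i, int (Suc m), Dbar)" and ?b = "(i, int m, D)"
  have a: "?a \<in> arcs_from (grid (4 * i + 2 * int (Suc m)) (2 * int (Suc m)))"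
    using Suc.prems by (subst arcs_from_A) auto
  have ea: "arc_end ?a = grid (4 * i + 2 * int m + 3) (2 * int m + 1)"
    by (simp only: arc_end_A) simp
  have b: "?b \<in> arcs_from (arc_end ?a)"
    unfolding ea using Suc.prems by (subst arcs_from_C) auto
  show ?case
    using a b q by (intro exI[of _ "?a # ?b # q"]) (simp only: walk.simps walk_end.simps arc_end_C)
qed

text \<open>One arc \<open>D\<close> reduces the third kind to the first, and one arc
  \<open>F\<close> reduces the second kind to the third.\<close>

lemma walk_down:
  assumes "node z"
  shows "\<exists>q. walk z q \<and> Im (walk_end z q) = 0"
proof -
  have A: "\<exists>q. walk (grid (4 * i + 2 * j) (2 * j)) q \<and> Im (walk_end (grid (4 * i + 2 * j) (2 * j)) q) = 0"
    if "0 \<le> 2 * i + j" "0 \<le> j" for i j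
    using walk_down_A[of i "nat j"] that by simp
  have C: "\<exists>q. walk (grid (4 * i + 2 * j + 3) (2 * j + 1)) q \<and>
      Im (walk_end (grid (4 * i + 2 * j + 3) (2 * j + 1)) q) = 0"
    if ij: "-1 \<le> 2 * i + j" "0 \<le> j" for i j
  proof -
    obtain q where "walk (arc_end (i, j, D)) q" "Im (walk_end (arc_end (i, j, D)) q) = 0"
      using A[of "i + 1" j] ij unfolding arc_end_C by auto
    then show ?thesis
      using ij by (intro exI[of _ "(i, j, D) # q"]) (simp add: arcs_from_C)
  qed
  from assms show ?thesis
  proof cases
    case (node_B i j)
    obtain q where "walk (arc_end (i, j, F)) q" "Im (walk_end (arc_end (i, j, F)) q) = 0"
      using C[of i j] node_B unfolding arc_end_B by auto
    then show ?thesis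
      using node_B
      by (intro exI[of _ "(i, j, F) # q"]) (simp add: arcs_from_B)
  qed (use A C in auto)
qed

lemma node_0: "node 0"
proof -
  have "0 = grid (4 * 0 + 2 * 0) (2 * 0)" by (simp add: complex_eq_iff)
  then show ?thesis using node_A[of 0 0] by simp
qed

text \<open>Prefixes of walks are walks; conversely \<open>walk_down\<close> completes any walk to a
  packing path.\<close>

lemma partial_packing_path_iff_walk: "partial_packing_path p \<longleftrightarrow> walk 0 p"
proof
  assume "partial_packing_path p"
  then show "walk 0 p"
    by (auto simp: partial_packing_path_def packing_path_def path_in_packing_iff_walk
        prefix_def walk_append)
next
  assume p: "walk 0 p"
  obtain q where q: "walk (walk_end 0 p) q" "Im (walk_end (walk_end 0 p) q) = 0"
    using walk_down[OF node_walk_end[OF node_0 p]] by blast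
  have "packing_path (p @ q)"
    unfolding packing_path_def path_in_packing_iff_walk endpoint_def
    using p q by (simp add: walk_append walk_end_conv_last[of 0 "p @ q", unfolded walk_end_append])
  then show "partial_packing_path p"
    unfolding partial_packing_path_def by (intro exI[of _ "p @ q"]) simp
qed

section \<open>Counting walks by linear recursions\<close>

definition walks :: "complex \<Rightarrow> nat \<Rightarrow> packing_arc list set" where
  "walks z n = {p. walk z p \<and> length p = n}"

lemma walks_0 [simp]: "walks z 0 = {[]}"
  by (auto simp: walks_def)

lemma walks_Suc: "walks z (Suc n) = (\<Union>a\<in>arcs_from z. (#) a ` walks (arc_end a) n)"
  by (auto simp: walks_def length_Suc_conv)

lemma finite_arcs_from: "node z \<Longrightarrow> finite (arcs_from z)"
  by (erule node.cases) (simp_all add: arcs_from_A arcs_from_B arcs_from_C)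

lemma finite_walks: "node z \<Longrightarrow> finite (walks z n)"
  by (induction n arbitrary: z) (auto simp: walks_Suc intro: finite_arcs_from node_arc_end)

lemma card_walks_Suc:
  assumes "node z"
  shows "card (walks z (Suc n)) = (\<Sum>a\<in>arcs_from z. card (walks (arc_end a) n))"
proof -
  have "card (walks z (Suc n)) = (\<Sum>a\<in>arcs_from z. card ((#) a ` walks (arc_end a) n))"
    unfolding walks_Suc using assms
    by (intro card_UN_disjoint) (auto intro: finite_arcs_from finite_walks node_arc_end)
  also have "\<dots> = (\<Sum>a\<in>arcs_from z. card (walks (arc_end a) n))"
    by (intro sum.cong refl card_image) auto
  finally show ?thesis .
qed

text \<open>The three families count the walks by the type of the starting node: \<open>A j\<close> for nodes at
  height \<open>2j\<close>, \<open>B j\<close> and \<open>C j\<close> for the two kinds of nodes at height \<open>2j + 1\<close>, heights being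
  measured in units of \<open>\<surd>3\<close>.\<close>

lemma card_walks_eq_fps_nth:
  fixes A B C :: "nat \<Rightarrow> real fps"
  assumes A: "\<And>j. A j = 1 + fps_X * (B j + (if j = 0 then 0 else C (j - 1)))"
    and B: "\<And>j. B j = 1 + fps_X * (C j + A (Suc j))"
    and C: "\<And>j. C j = 1 + fps_X * (A j + B j)"
  shows "0 \<le> 2 * i + int j \<Longrightarrow>
           real (card (walks (grid (4 * i + 2 * int j) (2 * int j)) n)) = A j $ n"
    and "0 \<le> 2 * i + int j \<Longrightarrow>
           real (card (walks (grid (4 * i + 2 * int j + 1) (2 * int j + 1)) n)) = B j $ n"
    and "-1 \<le> 2 * i + int j \<Longrightarrow>
           real (card (walks (grid (4 * i + 2 * int j + 3) (2 * int j + 1)) n)) = C j $ n"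
proof (induction n arbitrary: i j)
  case 0
  show "real (card (walks (grid (4 * i + 2 * int j) (2 * int j)) 0)) = A j $ 0" for i j
    by (subst A) simp
  show "real (card (walks (grid (4 * i + 2 * int j + 1) (2 * int j + 1)) 0)) = B j $ 0" for i j
    by (subst B) simp
  show "real (card (walks (grid (4 * i + 2 * int j + 3) (2 * int j + 1)) 0)) = C j $ 0" for i j
    by (subst C) simp
next
  case (Suc n)
  show "real (card (walks (grid (4 * i + 2 * int j) (2 * int j)) (Suc n))) = A j $ Suc n"
    if ij: "0 \<le> 2 * i + int j" for i j
  proof -
    have "A j $ Suc n = B j $ n + (if j = 0 then 0 else C (j - 1) $ n)"
      by (subst A) simp
    moreover have "real (card (walks (arc_end (i, int j, U)) n)) = B j $ n"
      unfolding arc_end_A using ij by (rule Suc.IH)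
    moreover have "real (card (walks (arc_end (i, int j, Dbar)) n)) = C (j - 1) $ n" if "j \<noteq> 0"
    proof -
      \<comment> \<open>The subtraction on naturals is exact because j is positive.\<close>
      have "int j - 1 = int (j - 1)" using that by simp
      then show ?thesis unfolding arc_end_A using ij that by (simp only: Suc.IH)
    qed
    ultimately show ?thesis
      using ij by (simp add: card_walks_Suc node_A arcs_from_A)
  qed
  show "real (card (walks (grid (4 * i + 2 * int j + 1) (2 * int j + 1)) (Suc n))) = B j $ Suc n"
    if ij: "0 \<le> 2 * i + int j" for i j
  proof -
    have "B j $ Suc n = C j $ n + A (Suc j) $ n"
      by (subst B) simp
    moreover have "real (card (walks (arc_end (i, int j, F)) n)) = C j $ n"
      unfolding arc_end_B using ij by (intro Suc.IH) simp
    moreover have "real (card (walks (arc_end (i - 1, int j + 1, Ubar)) n)) = A (Suc j) $ n"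
      unfolding arc_end_B using ij Suc.IH(1)[of i "Suc j"] by (simp add: add.commute)
    ultimately show ?thesis
      using ij by (simp add: card_walks_Suc node_B arcs_from_B)
  qed
  show "real (card (walks (grid (4 * i + 2 * int j + 3) (2 * int j + 1)) (Suc n))) = C j $ Suc n"
    if ij: "-1 \<le> 2 * i + int j" for i j
  proof -
    have "C j $ Suc n = A j $ n + B j $ n"
      by (subst C) simp
    moreover have "real (card (walks (arc_end (i, int j, D)) n)) = A j $ n"
      unfolding arc_end_C using ij by (intro Suc.IH) simp
    moreover have "real (card (walks (arc_end (i, int j + 1, Fbar)) n)) = B j $ n"
      unfolding arc_end_C using ij by (intro Suc.IH) simp
    ultimately show ?thesis
      using ij by (simp add: card_walks_Suc node_C arcs_from_C)
  qed
qed

text \<open>The recursions determine each coefficient from the preceding ones, so any solution is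
  the counting one. A closed form thus need only be verified.\<close>

lemma S_eq_if:
  fixes A B C :: "nat \<Rightarrow> real fps"
  assumes "\<And>j. A j = 1 + fps_X * (B j + (if j = 0 then 0 else C (j - 1)))"
    and "\<And>j. B j = 1 + fps_X * (C j + A (Suc j))"
    and "\<And>j. C j = 1 + fps_X * (A j + B j)"
  shows "S = A 0"
proof (rule fps_ext)
  fix n
  have "grid 0 0 = 0" by (simp add: complex_eq_iff)
  then show "S $ n = A 0 $ n"
    using card_walks_eq_fps_nth(1)[OF assms, of 0 0 n]
    by (simp add: S_def partial_packing_path_iff_walk walks_def)
qed

subsection \<open>The closed form\<close>

text \<open>Power series form an integral domain, and f + g has constant term 2.\<close>

lemma fps_square_eq_imp_eq:
  fixes f g :: "real fps"
  assumes "f ^ 2 = g ^ 2" "f $ 0 = 1" "g $ 0 = 1"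
  shows "f = g"
proof -
  have "(f - g) * (f + g) = 0" using assms(1) by (simp add: algebra_simps power2_eq_square)
  moreover have "(f + g) $ 0 \<noteq> 0" using assms by simp
  then have "f + g \<noteq> 0" by (metis fps_zero_nth)
  ultimately show ?thesis by simp
qed

lemma fps_sqrt_square:
  assumes "f $ 0 = 1"
  shows "fps_sqrt f ^ 2 = f"
  unfolding fps_sqrt_def using assms power_radical[of f root 1] by (simp add: numeral_2_eq_2)

lemma fps_sqrt_nth_0: "f $ 0 = 1 \<Longrightarrow> fps_sqrt f $ 0 = 1"
  by (simp add: fps_sqrt_def)

lemma S_closed_form:
  fixes R :: "real fps"
  assumes R: "R ^ 2 = 1 - 2 * fps_X + fps_X ^ 2 - 4 * fps_X ^ 3 + 4 * fps_X ^ 4" and R0: "R $ 0 = 1"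
  shows "2 * fps_X ^ 2 * (-1 + 2 * fps_X) * S = 1 - fps_X - 2 * fps_X ^ 2 - R"
proof -
  let ?X = "fps_X :: real fps"
  \<comment> \<open>The coefficients of x and x^2 in \<open>R\<close> are read off from its square;
    they make 1 - x - R divisible by x^3.\<close>
  have sq: "(R ^ 2) $ n = (\<Sum>i=0..n. R $ i * R $ (n - i))" for n
    by (simp add: power2_eq_square fps_mult_nth)
  have "R $ 0 * R $ 1 + R $ 1 * R $ 0 = -2"
    using sq[of 1] unfolding R by (simp add: fps_X_power_nth mult.commute)
  then have R1: "R $ 1 = -1" using R0 by simp
  have "R $ 0 * R $ 2 + R $ 1 * R $ 1 + R $ 2 * R $ 0 = 1"
    using sq[of 2] unfolding R by (simp add: fps_X_power_nth numeral_2_eq_2 fps_numeral_nth)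
  then have R2: "R $ 2 = 0" using R0 R1 by simp
  define E where "E = fps_shift 3 (fps_const (1/2) * (1 - ?X - R))"
  have E: "2 * ?X ^ 3 * E = 1 - ?X - R"
  proof -
    have "2 * ?X ^ 3 * E = ?X ^ 3 * fps_shift 3 (1 - ?X - R)"
      by (rule fps_ext) (simp add: E_def numeral_fps_const fps_X_power_mult_nth mult.assoc)
    also have "\<dots> = 1 - ?X - R"
    proof (rule fps_ext)
      fix n
      have "(1 - ?X - R) $ n = 0" if "n < 3"
      proof -
        from that have "n = 0 \<or> n = 1 \<or> n = 2" by linarith
        then show ?thesis using R0 R1 R2 by auto
      qed
      then show "(?X ^ 3 * fps_shift 3 (1 - ?X - R)) $ n = (1 - ?X - R) $ n"
        by (simp add: fps_X_power_mult_nth del: fps_sub_nth)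
    qed
    finally show ?thesis .
  qed
  \<comment> \<open>Substituting R = 1 - x - 2 x^3 E into the formula for R^2 gives a quadratic
    equation for \<open>E\<close>, up to the factor 4 x^3.\<close>
  have "4 * ?X ^ 3 * (?X ^ 3 * E ^ 2) = 4 * ?X ^ 3 * ((1 - ?X) * (E - 1))"
    using R E by algebra
  then have E2: "?X ^ 3 * E ^ 2 = (1 - ?X) * (E - 1)" by simp
  define V where "V = inverse (1 - ?X)"
  define W where "W = inverse (1 - 2 * ?X)"
  have V: "(1 - ?X) * V = 1"
    unfolding V_def by (rule inverse_mult_eq_1') simp
  have W: "(1 - 2 * ?X) * W = 1"
    unfolding W_def by (rule inverse_mult_eq_1') simp
  define t where "t = ?X * E"
  \<comment> \<open>Solving t = x + x K t with t = x E gives K = (E - 1) / (x E); the quadratic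
    equation turns this into a form without division by x.\<close>
  define K where "K = ?X ^ 2 * E * V"
  define H where "H = ?X + ?X * K"
  have t_rec: "t = ?X + ?X * K * t"
    unfolding t_def K_def using E2 V by algebra
  have K_rec: "K = ?X * H * (1 + t)"
    unfolding H_def t_def K_def using E2 V by algebra
  \<comment> \<open>Two arcs leave every node of the unrestricted graph, so W = 1 + 2 x W. What
    remains are the first-passage equations times a common factor. In \<open>rec_A0\<close> the term
    x in the equation for \<open>t\<close> accounts for the forbidden downward arc.\<close>
  have rec_A0: "W * (1 - t) = 1 + ?X * (W * (1 - K * t))"
    using W t_rec by algebra
  have rec_A: "W * (1 - t * (t * H * P)) =
      1 + ?X * (W * (1 - K * t * (t * H * P)) + W * (1 - H * t * P))" for P
    using W t_rec by algebra
  have rec_B: "W * (1 - K * t * P) =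
      1 + ?X * (W * (1 - H * t * P) + W * (1 - t * (t * H * P)))" for P
    using W K_rec by algebra
  have rec_C: "W * (1 - H * t * P) = 1 + ?X * (W * (1 - t * P) + W * (1 - K * t * P))" for P
    using W H_def by algebra
  \<comment> \<open>On the way down the first passages \<open>t\<close> and \<open>H\<close>
    alternate, so each pair of unit levels contributes \<open>t * H\<close>. From the second kind of
    node, \<open>K\<close> leads to height 2j and \<open>t\<close> one unit lower.\<close>
  define A where "A = (\<lambda>j. W * (1 - t * (t * H) ^ j))"
  define B where "B = (\<lambda>j. W * (1 - K * t * (t * H) ^ j))"
  define C where "C = (\<lambda>j. W * (1 - H * t * (t * H) ^ j))"
  have "S = A 0"
  proof (rule S_eq_if)
    fix j
    show "A j = 1 + ?X * (B j + (if j = 0 then 0 else C (j - 1)))"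
    proof (cases j)
      case 0
      then show ?thesis unfolding A_def B_def using rec_A0 by simp
    next
      case (Suc m)
      then show ?thesis unfolding A_def B_def C_def using rec_A[of "(t * H) ^ m"] by simp
    qed
    show "B j = 1 + ?X * (C j + A (Suc j))"
      unfolding A_def B_def C_def using rec_B[of "(t * H) ^ j"] by simp
    show "C j = 1 + ?X * (A j + B j)"
      unfolding A_def B_def C_def by (rule rec_C)
  qed
  then have "S = W * (1 - ?X * E)" by (simp add: A_def t_def)
  then show ?thesis using W E by algebra
qed

subsection \<open>Asymptotics\<close>

text \<open>The number \<open>(2n choose n) / 4\<^sup>n\<close>, the coefficient of \<open>x\<^sup>n\<close> in \<open>(1 - x) powr (- 1 / 2)\<close>.\<close>

definition central_ratio :: "nat \<Rightarrow> real" where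
  "central_ratio n = (-1) ^ n * ((-1/2) gchoose n)"

lemma central_ratio_0: "central_ratio 0 = 1"
  by (simp add: central_ratio_def)

lemma central_ratio_Suc: "central_ratio (Suc n) = central_ratio n * ((2 * real n + 1) / (2 * real n + 2))"
proof -
  define x where "x = (-1/2 :: real) gchoose n"
  define y where "y = (-1/2 :: real) gchoose Suc n"
  have "(-1/2) * x = real n * x + real (Suc n) * y"
    using gbinomial_mult_1[of "-1/2 :: real" n] by (simp only: x_def y_def)
  then have "- y * (2 * real n + 2) = x * (2 * real n + 1)" by (simp add: algebra_simps)
  then have "- y = x * ((2 * real n + 1) / (2 * real n + 2))" by (simp add: field_simps)
  then have "(-1) ^ n * (- y) = (-1) ^ n * (x * ((2 * real n + 1) / (2 * real n + 2)))" by (rule arg_cong)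
  then show ?thesis unfolding central_ratio_def x_def[symmetric] y_def[symmetric] by simp
qed

lemma central_ratio_pos: "0 < central_ratio n"
  by (induction n) (simp_all add: central_ratio_0 central_ratio_Suc)

text \<open>The ratio of consecutive weighted terms is (2n + 1)(n + 2) / ((2n + 2)(n + 1)), which is
  at least 1.\<close>

lemma central_ratio_weighted_mono: "central_ratio m * (real m + 1) \<le> central_ratio (m + k) * (real (m + k) + 1)"
proof (induction k)
  case (Suc k)
  define n where "n = m + k"
  have "central_ratio n * (real n + 1) \<le> central_ratio n * ((2 * real n + 1) / (2 * real n + 2) * (real n + 2))"
    by (intro mult_left_mono order.strict_implies_order[OF central_ratio_pos]) (simp add: field_simps)
  then have "central_ratio n * (real n + 1) \<le> central_ratio (Suc n) * (real (Suc n) + 1)"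
    by (simp add: central_ratio_Suc algebra_simps)
  with Suc.IH show ?case by (simp add: n_def)
qed simp

text \<open>Shifting the index back by k costs at most a factor linear in k, because m + k + 1 \<le>
  (k + 1)(m + 1). This supplies the domination for Tannery's theorem.\<close>

lemma central_ratio_bound: "k \<le> n \<Longrightarrow> central_ratio (n - k) \<le> (real k + 1) * central_ratio n"
proof -
  assume "k \<le> n"
  then obtain m where m: "n = m + k" by (metis le_add_diff_inverse2)
  have "central_ratio m * (real m + 1) \<le> central_ratio n * (real m + real k + 1)"
    using central_ratio_weighted_mono[of m k] m by simp
  also have "\<dots> \<le> central_ratio n * ((real k + 1) * (real m + 1))"
    by (intro mult_left_mono order.strict_implies_order[OF central_ratio_pos]) (simp add: algebra_simps)
  finally have "central_ratio m * (real m + 1) \<le> ((real k + 1) * central_ratio n) * (real m + 1)"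
    by (simp add: mult_ac)
  then have "central_ratio m \<le> (real k + 1) * central_ratio n" by (simp add: mult_le_cancel_right)
  then show ?thesis using m by simp
qed

text \<open>This is the Gamma function asymptotics of generalized binomial coefficients at -1/2,
  with Gamma(1/2) = sqrt pi.\<close>

lemma central_ratio_asymptotic: "(\<lambda>n. central_ratio n * sqrt (real n)) \<longlonglongrightarrow> 1 / sqrt pi"
proof -
  have "(\<lambda>n. ((-1/2 :: real) gchoose n) / ((-1)^n / exp ((-1/2+1) * of_real (ln (real n)))))
      \<longlonglongrightarrow> inverse (Gamma (1/2))"
    using gbinomial_asymptotic[of "-1/2 :: real"] by simp
  moreover have "\<forall>\<^sub>F n in sequentially. ((-1/2 :: real) gchoose n) /
      ((-1)^n / exp ((-1/2+1) * of_real (ln (real n)))) = central_ratio n * sqrt (real n)"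
    using eventually_gt_at_top[of 0]
  proof eventually_elim
    case (elim n)
    have "exp ((-1/2+1) * of_real (ln (real n))) = real n powr (1/2)"
      using elim by (simp add: powr_def)
    then show ?case using elim by (simp add: powr_half_sqrt central_ratio_def minus_one_power_iff)
  qed
  ultimately show ?thesis
    by (simp add: Gamma_one_half_real inverse_eq_divide tendsto_cong)
qed

lemma central_ratio_shift_asymptotic: "(\<lambda>n. central_ratio n * sqrt (real (n + k))) \<longlonglongrightarrow> 1 / sqrt pi"
proof -
  have "(\<lambda>n. sqrt (real (n + k) / real n)) \<longlonglongrightarrow> 1"
    by real_asymp
  then have "(\<lambda>n. (central_ratio n * sqrt (real n)) * sqrt (real (n + k) / real n)) \<longlonglongrightarrow> 1 / sqrt pi * 1"
    by (intro tendsto_mult central_ratio_asymptotic)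
  moreover have "\<forall>\<^sub>F n in sequentially. (central_ratio n * sqrt (real n)) * sqrt (real (n + k) / real n)
      = central_ratio n * sqrt (real (n + k))"
    using eventually_gt_at_top[of 0] by eventually_elim (simp add: real_sqrt_divide)
  ultimately show ?thesis using Lim_transform_eventually by fastforce
qed

text \<open>Tannery's theorem applies with the dominating terms |c k| (k + 1) M, where M bounds
  \<open>central_ratio n * sqrt (real n)\<close>; hence the weight k + 1 in the hypothesis.\<close>

lemma convolution_asymptotic:
  fixes c :: "nat \<Rightarrow> real"
  assumes "summable (\<lambda>k. \<bar>c k\<bar> * (real k + 1))"
  shows "(\<lambda>n. (\<Sum>k\<le>n. c k * central_ratio (n - k)) * sqrt (real n)) \<longlonglongrightarrow> (\<Sum>k. c k) / sqrt pi"
proof -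
  obtain M where M: "central_ratio n * sqrt (real n) \<le> M" for n
  proof -
    have "Bseq (\<lambda>n. central_ratio n * sqrt (real n))"
      by (rule convergent_imp_Bseq) (auto simp: convergent_def intro: central_ratio_asymptotic)
    then obtain M where "\<And>n. norm (central_ratio n * sqrt (real n)) \<le> M" by (auto simp: Bseq_def)
    then show ?thesis using that[of M] by (metis abs_le_D1 real_norm_def)
  qed
  \<comment> \<open>Extension by 0 for k > n turns the finite sums into series over all k.\<close>
  define a where "a = (\<lambda>k n. if k \<le> n then c k * central_ratio (n - k) * sqrt (real n) else 0)"
  have lim: "(\<lambda>n. a k n) \<longlonglongrightarrow> c k * (1 / sqrt pi)" for k
  proof (rule LIMSEQ_offset)
    have "(\<lambda>n. c k * (central_ratio n * sqrt (real (n + k)))) \<longlonglongrightarrow> c k * (1 / sqrt pi)"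
      by (intro tendsto_mult tendsto_const central_ratio_shift_asymptotic)
    then show "(\<lambda>n. a k (n + k)) \<longlonglongrightarrow> c k * (1 / sqrt pi)"
      by (simp add: a_def mult.assoc)
  qed
  have bound: "norm (a k n) \<le> \<bar>c k\<bar> * (real k + 1) * M" for k n
  proof (cases "k \<le> n")
    case True
    have "central_ratio (n - k) * sqrt (real n) \<le> (real k + 1) * central_ratio n * sqrt (real n)"
      by (intro mult_right_mono central_ratio_bound True) simp
    also have "\<dots> = (real k + 1) * (central_ratio n * sqrt (real n))" by simp
    also have "\<dots> \<le> (real k + 1) * M" by (intro mult_left_mono M) simp
    finally have "\<bar>c k\<bar> * (central_ratio (n - k) * sqrt (real n)) \<le> \<bar>c k\<bar> * ((real k + 1) * M)"
      by (rule mult_left_mono) simp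
    then show ?thesis using True central_ratio_pos[of "n - k"] by (simp add: a_def abs_mult mult.assoc)
  next
    case False
    have "0 \<le> M" using M[of 0] by simp
    then show ?thesis using False by (simp add: a_def)
  qed
  have "\<forall>\<^sub>F (k, n) in at_top \<times>\<^sub>F sequentially. norm (a k n) \<le> \<bar>c k\<bar> * (real k + 1) * M"
    by (rule always_eventually) (use bound in auto)
  from tannerys_theorem[OF lim this summable_mult2[OF assms] sequentially_bot]
  have "(\<lambda>n. \<Sum>k. a k n) \<longlonglongrightarrow> (\<Sum>k. c k * (1 / sqrt pi))"
    by (elim conjE)
  moreover have "(\<Sum>k. a k n) = (\<Sum>k\<le>n. c k * central_ratio (n - k)) * sqrt (real n)" for n
  proof -
    have "(\<Sum>k. a k n) = (\<Sum>k\<le>n. a k n)" by (rule suminf_finite) (auto simp: a_def)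
    then show ?thesis by (simp add: a_def sum_distrib_right)
  qed
  moreover have "(\<Sum>k. c k * (1 / sqrt pi)) = (\<Sum>k. c k) / sqrt pi"
  proof -
    have "summable (\<lambda>k. \<bar>c k\<bar>)"
      by (rule summable_comparison_test[OF _ assms])
        (auto intro!: exI[of _ 0] simp: mult_le_cancel_left1)
    then have "summable c" by (rule summable_rabs_cancel)
    then show ?thesis using suminf_mult2[of c "1 / sqrt pi"] by simp
  qed
  ultimately show ?thesis by simp
qed

section \<open>Majorants for square roots of power series\<close>

text \<open>As p 0 = 0, only pairs of positive indices count, and i + j \<le> N + 1 then forces both
  to be at most N. The bound at N + 1 thus involves only partial sums up to N, as induction
  requires.\<close>

lemma sum_convolution_le_square:
  fixes p :: "nat \<Rightarrow> real"
  assumes "p 0 = 0" "\<And>n. 0 \<le> p n"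
  shows "(\<Sum>n\<le>Suc N. \<Sum>i\<le>n. p i * p (n - i)) \<le> (\<Sum>n\<le>N. p n) ^ 2"
proof -
  let ?T = "{(i, j). i + j \<le> Suc N}"
  have fin: "finite ?T"
    by (rule finite_subset[of _ "{..Suc N} \<times> {..Suc N}"]) auto
  have "(\<Sum>n\<le>Suc N. \<Sum>i\<le>n. p i * p (n - i)) = (\<Sum>(i, j)\<in>?T. p i * p j)"
    by (rule sum.triangle_reindex_eq[symmetric])
  also have "\<dots> = (\<Sum>(i, j)\<in>?T \<inter> {(i, j). i \<noteq> 0 \<and> j \<noteq> 0}. p i * p j)"
    using fin assms(1) by (intro sum.mono_neutral_right) (auto intro!: gr0I)
  also have "\<dots> \<le> (\<Sum>(i, j)\<in>{..N} \<times> {..N}. p i * p j)"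
    using assms(2) by (intro sum_mono2) auto
  also have "\<dots> = (\<Sum>n\<le>N. p n) ^ 2"
    by (simp add: power2_eq_square sum_product sum.cartesian_product)
  finally show ?thesis .
qed

text \<open>The hypothesis on \<open>g\<close> says (1 - g)^2 = 1 - u. The weighted partial sums s
  of |g| satisfy 2 s(N + 1) \<le> q + s(N)^2, so the bound b is preserved when q + b^2 \<le>
  2b.\<close>

lemma fps_quadratic_majorant:
  fixes g u :: "real fps"
  assumes g: "2 * g = u + g ^ 2" and g0: "g $ 0 = 0"
    and r: "0 \<le> r" and u: "\<And>N. (\<Sum>n\<le>N. \<bar>u $ n\<bar> * r ^ n) \<le> q" and b: "q + b ^ 2 \<le> 2 * b" "0 \<le> b"
  shows "(\<Sum>n\<le>N. \<bar>g $ n\<bar> * r ^ n) \<le> b"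
proof (induction N)
  case 0
  then show ?case using g0 b by simp
next
  case (Suc N)
  define p where "p = (\<lambda>n. \<bar>g $ n\<bar> * r ^ n)"
  have p_nonneg: "0 \<le> p n" for n using r by (simp add: p_def)
  have p_rec: "2 * p n \<le> \<bar>u $ n\<bar> * r ^ n + (\<Sum>i\<le>n. p i * p (n - i))" for n
  proof -
    have "2 * g $ n = (2 * g) $ n" by (simp add: numeral_fps_const)
    also have "\<dots> = u $ n + (\<Sum>i\<le>n. g $ i * g $ (n - i))"
      unfolding g by (simp add: power2_eq_square fps_mult_nth atLeast0AtMost)
    finally have "2 * \<bar>g $ n\<bar> \<le> \<bar>u $ n\<bar> + (\<Sum>i\<le>n. \<bar>g $ i\<bar> * \<bar>g $ (n - i)\<bar>)"
      using sum_abs[of "\<lambda>i. g $ i * g $ (n - i)" "{..n}"] by (simp add: abs_mult)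
    then have "2 * \<bar>g $ n\<bar> * r ^ n \<le> (\<bar>u $ n\<bar> + (\<Sum>i\<le>n. \<bar>g $ i\<bar> * \<bar>g $ (n - i)\<bar>)) * r ^ n"
      using r by (intro mult_right_mono) auto
    also have "\<dots> = \<bar>u $ n\<bar> * r ^ n + (\<Sum>i\<le>n. \<bar>g $ i\<bar> * \<bar>g $ (n - i)\<bar> * r ^ n)"
      by (simp add: distrib_right sum_distrib_right)
    also have "(\<Sum>i\<le>n. \<bar>g $ i\<bar> * \<bar>g $ (n - i)\<bar> * r ^ n) = (\<Sum>i\<le>n. p i * p (n - i))"
      by (intro sum.cong refl) (simp add: p_def mult_ac flip: power_add)
    finally show ?thesis by (simp add: p_def mult_ac)
  qed
  have "2 * (\<Sum>n\<le>Suc N. p n) = (\<Sum>n\<le>Suc N. 2 * p n)" by (rule sum_distrib_left)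
  also have "\<dots> \<le> (\<Sum>n\<le>Suc N. \<bar>u $ n\<bar> * r ^ n + (\<Sum>i\<le>n. p i * p (n - i)))"
    by (intro sum_mono p_rec)
  also have "\<dots> = (\<Sum>n\<le>Suc N. \<bar>u $ n\<bar> * r ^ n) + (\<Sum>n\<le>Suc N. \<Sum>i\<le>n. p i * p (n - i))"
    by (rule sum.distrib)
  also have "\<dots> \<le> q + (\<Sum>n\<le>N. p n) ^ 2"
    by (intro add_mono u sum_convolution_le_square p_nonneg) (simp add: p_def g0)
  also have "\<dots> \<le> q + b ^ 2"
    using Suc.IH by (intro add_left_mono power_mono sum_nonneg p_nonneg) (simp add: p_def)
  also have "\<dots> \<le> 2 * b" by (fact b)
  finally show ?case by (simp add: p_def)
qed

lemma summable_imp_Cauchy_square: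
  fixes c :: "real fps"
  assumes "summable (\<lambda>n. \<bar>c $ n\<bar> * x ^ n)" "0 \<le> x"
  shows "(\<Sum>n. c $ n * x ^ n) ^ 2 = (\<Sum>n. (c ^ 2) $ n * x ^ n)"
proof -
  have "summable (\<lambda>n. norm (c $ n * x ^ n))"
    using assms by (simp add: abs_mult)
  then have "(\<Sum>n. c $ n * x ^ n) ^ 2 = (\<Sum>n. \<Sum>i\<le>n. (c $ i * x ^ i) * (c $ (n - i) * x ^ (n - i)))"
    unfolding power2_eq_square by (intro Cauchy_product)
  moreover have "(\<Sum>i\<le>n. (c $ i * x ^ i) * (c $ (n - i) * x ^ (n - i))) = (c ^ 2) $ n * x ^ n" for n
  proof -
    have "(\<Sum>i\<le>n. (c $ i * x ^ i) * (c $ (n - i) * x ^ (n - i))) = (\<Sum>i\<le>n. c $ i * c $ (n - i) * x ^ n)"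
      by (intro sum.cong refl) (simp add: mult_ac flip: power_add)
    then show ?thesis
      by (simp add: power2_eq_square fps_mult_nth atLeast0AtMost sum_distrib_right)
  qed
  ultimately show ?thesis by simp
qed

section \<open>The factor (1 + x^2 - 2 x^3)^(1/2) at 1/2\<close>

context
  fixes c :: "real fps"
  assumes c_square: "c ^ 2 = 1 + fps_X ^ 2 - 2 * fps_X ^ 3" and c_0: "c $ 0 = 1"
begin

text \<open>With r = b = 3/5 the majorant condition reads 99/125 + 45/125 \<le> 150/125. The radius
  exceeds 1/2, which gives summability there, and b < 1 later fixes a sign.\<close>

lemma sum_abs_one_minus_sqrt_le: "(\<Sum>n\<le>N. \<bar>(1 - c) $ n\<bar> * (3 / 5) ^ n) \<le> 3 / 5"
proof (rule fps_quadratic_majorant)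
  define u :: "real fps" where "u = 2 * fps_X ^ 3 - fps_X ^ 2"
  show "2 * (1 - c) = u + (1 - c) ^ 2"
    using c_square by (simp add: u_def power2_eq_square algebra_simps)
  have u_nth: "u $ n = (if n = 3 then 2 else if n = 2 then -1 else 0)" for n
    by (simp add: u_def numeral_fps_const fps_X_power_nth)
  show "(\<Sum>n\<le>N. \<bar>u $ n\<bar> * (3 / 5) ^ n) \<le> 2 * (3 / 5) ^ 3 + (3 / 5) ^ 2" for N
  proof -
    have "(\<Sum>n\<le>N. \<bar>u $ n\<bar> * (3 / 5) ^ n) \<le> (\<Sum>n\<in>{..N} \<union> {2, 3}. \<bar>u $ n\<bar> * (3 / 5) ^ n)"
      by (intro sum_mono2) auto
    also have "\<dots> = (\<Sum>n\<in>{2, 3}. \<bar>u $ n\<bar> * (3 / 5) ^ n)"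
      by (intro sum.mono_neutral_right) (auto simp: u_nth)
    finally show ?thesis by (simp add: u_nth)
  qed
qed (auto simp: c_0 power2_eq_square power3_eq_cube)

lemma abs_sqrt_coeff_le: "\<bar>c $ n\<bar> * (3 / 5) ^ n \<le> 1"
proof (cases "n = 0")
  case False
  have "\<bar>(1 - c) $ n\<bar> * (3 / 5) ^ n \<le> (\<Sum>k\<le>n. \<bar>(1 - c) $ k\<bar> * (3 / 5) ^ k)"
    by (rule member_le_sum) auto
  also have "\<dots> \<le> 3 / 5" by (rule sum_abs_one_minus_sqrt_le)
  finally show ?thesis using False by simp
qed (simp add: c_0)

lemma summable_abs_sqrt_coeff_weighted: "summable (\<lambda>n. \<bar>c $ n * (1 / 2) ^ n\<bar> * (real n + 1))"
proof (rule summable_comparison_test)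
  have "\<bar>c $ n * (1 / 2) ^ n\<bar> \<le> (5 / 6) ^ n" for n
  proof -
    \<comment> \<open>The ratio 5/6 is (1/2) / (3/5).\<close>
    have "\<bar>c $ n\<bar> * (1 / 2) ^ n = (\<bar>c $ n\<bar> * (3 / 5) ^ n) * (5 / 6) ^ n"
      by (simp add: mult.assoc flip: power_mult_distrib)
    also have "\<dots> \<le> 1 * (5 / 6) ^ n" by (intro mult_right_mono abs_sqrt_coeff_le) simp
    finally show ?thesis by (simp add: abs_mult power_abs)
  qed
  then show "\<exists>N. \<forall>n\<ge>N. norm (\<bar>c $ n * (1 / 2) ^ n\<bar> * (real n + 1)) \<le> (5 / 6) ^ n * (real n + 1)"
    by (intro exI[of _ 0]) (auto simp: abs_mult intro!: mult_right_mono)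
  show "summable (\<lambda>n. (5 / 6) ^ n * (real n + 1))"
  proof (rule summable_comparison_test_bigo)
    show "summable (\<lambda>n. norm ((9 / 10 :: real) ^ n))" by (simp add: summable_geometric)
    show "(\<lambda>n. (5 / 6) ^ n * (real n + 1)) \<in> O(\<lambda>n. (9 / 10) ^ n)" by real_asymp
  qed
qed

lemma summable_abs_sqrt_coeff: "summable (\<lambda>n. \<bar>c $ n\<bar> * (1 / 2) ^ n)"
proof (rule summable_comparison_test[OF _ summable_abs_sqrt_coeff_weighted])
  have "\<bar>c $ n\<bar> * (1 / 2) ^ n * 1 \<le> \<bar>c $ n\<bar> * (1 / 2) ^ n * (real n + 1)" for n
    by (intro mult_left_mono) auto
  then show "\<exists>N. \<forall>n\<ge>N. norm (\<bar>c $ n\<bar> * (1 / 2) ^ n) \<le> \<bar>c $ n * (1 / 2) ^ n\<bar> * (real n + 1)"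
    by (simp add: abs_mult power_abs)
qed

text \<open>The square of the value is 1 + 1/4 - 2/8 = 1. The sign is positive because the partial
  sums for 1 - c at 1/2 never exceed 3/5.\<close>

lemma suminf_sqrt_coeff: "(\<Sum>n. c $ n * (1 / 2) ^ n) = 1"
proof -
  define s where "s = (\<Sum>n. c $ n * (1 / 2) ^ n)"
  have c2_nth: "(c ^ 2) $ n = (if n = 0 then 1 else if n = 2 then 1 else if n = 3 then -2 else 0)" for n
    by (simp add: c_square numeral_fps_const fps_X_power_nth)
  have "s ^ 2 = (\<Sum>n. (c ^ 2) $ n * (1 / 2) ^ n)"
    unfolding s_def by (intro summable_imp_Cauchy_square summable_abs_sqrt_coeff) simp
  also have "\<dots> = (\<Sum>n\<in>{0, 2, 3}. (c ^ 2) $ n * (1 / 2) ^ n)"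
    by (rule suminf_finite) (auto simp: c2_nth)
  also have "\<dots> = 1" by (simp add: c2_nth power_one_over)
  finally have "s = 1 \<or> s = -1" by (simp add: power2_eq_1_iff)
  moreover have "0 \<le> s"
  proof (rule LIMSEQ_le_const)
    have "summable (\<lambda>n. c $ n * (1 / 2) ^ n)"
      using summable_abs_sqrt_coeff by (intro summable_rabs_cancel[where f = "\<lambda>n. c $ n * (1 / 2) ^ n"])
        (simp add: abs_mult power_abs)
    then show "(\<lambda>N. \<Sum>n\<le>N. c $ n * (1 / 2) ^ n) \<longlonglongrightarrow> s"
      unfolding s_def by (rule summable_LIMSEQ')
    have "0 \<le> (\<Sum>n\<le>N. c $ n * (1 / 2) ^ n)" for N
    proof -
      have "(\<Sum>n\<le>N. (1 - c) $ n * (1 / 2) ^ n) \<le> (\<Sum>n\<le>N. \<bar>(1 - c) $ n\<bar> * (3 / 5) ^ n)"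
        by (intro sum_mono mult_mono power_mono) auto
      also have "\<dots> \<le> 3 / 5" by (rule sum_abs_one_minus_sqrt_le)
      finally have "(\<Sum>n\<le>N. (1 :: real fps) $ n * (1 / 2) ^ n) - (\<Sum>n\<le>N. c $ n * (1 / 2) ^ n) \<le> 3 / 5"
        by (simp add: left_diff_distrib sum_subtractf)
      moreover have "(\<Sum>n\<le>N. (1 :: real fps) $ n * (1 / 2) ^ n) = (\<Sum>n\<in>{0}. (1 :: real fps) $ n * (1 / 2) ^ n)"
        by (rule sum.mono_neutral_right) auto
      ultimately show ?thesis by simp
    qed
    then show "\<exists>N. \<forall>n\<ge>N. 0 \<le> (\<Sum>n\<le>n. c $ n * (1 / 2) ^ n)" by blast
  qed
  ultimately show ?thesis unfolding s_def by auto
qed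

end

section \<open>The factor (1 - 2x)^(-1/2) and the final estimate\<close>

definition inv_sqrt_series :: "real fps" where
  "inv_sqrt_series = Abs_fps (\<lambda>n. 2 ^ n * central_ratio n)"

text \<open>The coefficients are (-2)^n times those of (1 + x)^(-1/2), whose square is (1 + x)^(-1)
  by addition of exponents.\<close>

lemma inv_sqrt_series_square: "inv_sqrt_series ^ 2 * (1 - 2 * fps_X) = 1"
proof -
  have "inv_sqrt_series ^ 2 = Abs_fps (\<lambda>n. 2 ^ n)"
  proof (rule fps_ext)
    fix n
    let ?b = "fps_binomial (-1/2 :: real)"
    have "(inv_sqrt_series ^ 2) $ n = (\<Sum>i=0..n. (-2) ^ n * (?b $ i * ?b $ (n - i)))"
      unfolding power2_eq_square fps_mult_nth
    proof (intro sum.cong refl)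
      fix i assume "i \<in> {0..n}"
      then obtain j where j: "n = i + j" by (auto simp: nat_le_iff_add)
      show "inv_sqrt_series $ i * inv_sqrt_series $ (n - i) = (-2) ^ n * (?b $ i * ?b $ (n - i))"
        by (simp add: inv_sqrt_series_def central_ratio_def j power_add power_minus[of 2] mult_ac)
    qed
    also have "\<dots> = (-2) ^ n * (?b * ?b) $ n"
      by (simp add: fps_mult_nth sum_distrib_left)
    also have "?b * ?b = fps_binomial (-1)"
      by (simp flip: fps_binomial_add_mult)
    also have "(-2) ^ n * fps_binomial (-1 :: real) $ n = Abs_fps (\<lambda>n. 2 ^ n) $ n"
      by (simp add: gbinomial_minus power_minus[of 2] binomial_gbinomial[symmetric])
    finally show "(inv_sqrt_series ^ 2) $ n = Abs_fps (\<lambda>n. 2 ^ n) $ n" .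
  qed
  moreover have "Abs_fps (\<lambda>n. 2 ^ n) * (1 - 2 * fps_X) = (1 :: real fps)"
  proof (rule fps_ext)
    fix n
    show "(Abs_fps (\<lambda>n. 2 ^ n) * (1 - 2 * fps_X)) $ n = (1 :: real fps) $ n"
      by (cases n) (simp_all add: algebra_simps numeral_fps_const)
  qed
  ultimately show ?thesis by simp
qed

theorem corollary7:
  shows "fps_to_fls S =
           fps_to_fls (1 - fps_X - 2 * fps_X ^ 2
             - fps_sqrt (1 - 2 * fps_X + fps_X ^ 2 - 4 * fps_X ^ 3 + 4 * fps_X ^ 4))
           / fps_to_fls (2 * fps_X ^ 2 * (-1 + 2 * fps_X))
       \<and> (\<lambda>n. fps_nth S n) \<sim>[at_top] (\<lambda>n. 2 ^ (n + 1) / sqrt (pi * real n))"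
proof
  let ?X = "fps_X :: real fps"
  define R where "R = fps_sqrt (1 - 2 * ?X + ?X ^ 2 - 4 * ?X ^ 3 + 4 * ?X ^ 4)"
  have R2: "R ^ 2 = 1 - 2 * ?X + ?X ^ 2 - 4 * ?X ^ 3 + 4 * ?X ^ 4"
    unfolding R_def by (rule fps_sqrt_square) simp
  have R0: "R $ 0 = 1"
    unfolding R_def by (rule fps_sqrt_nth_0) simp
  have S: "2 * ?X ^ 2 * (-1 + 2 * ?X) * S = 1 - ?X - 2 * ?X ^ 2 - R"
    by (rule S_closed_form[OF R2 R0])
  have "(-1 + 2 * ?X) $ 0 \<noteq> 0" by simp
  then have "-1 + 2 * ?X \<noteq> 0" by (metis fps_zero_nth)
  then have "fps_to_fls (2 * ?X ^ 2 * (-1 + 2 * ?X)) \<noteq> 0"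
    by (simp only: fps_to_fls_eq_0_iff mult_eq_0_iff power_eq_0_iff) simp
  moreover have "fps_to_fls S * fps_to_fls (2 * ?X ^ 2 * (-1 + 2 * ?X)) =
      fps_to_fls (1 - ?X - 2 * ?X ^ 2 - R)"
    by (simp only: S[symmetric] fls_times_fps_to_fls[symmetric] mult.commute)
  ultimately show "fps_to_fls S =
      fps_to_fls (1 - ?X - 2 * ?X ^ 2 - R) / fps_to_fls (2 * ?X ^ 2 * (-1 + 2 * ?X))"
    by (rule nonzero_eq_divide_eq[THEN iffD2])
  define c where "c = fps_sqrt (1 + ?X ^ 2 - 2 * ?X ^ 3)"
  have c2: "c ^ 2 = 1 + ?X ^ 2 - 2 * ?X ^ 3"
    unfolding c_def by (rule fps_sqrt_square) simp
  have c0: "c $ 0 = 1"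
    unfolding c_def by (rule fps_sqrt_nth_0) simp
  \<comment> \<open>By the closed form, (1 - 2x)(1 + x + 2 x^2 S) = R, and R^2 factors as (1 - 2x)(1
    + x^2 - 2 x^3). Hence the squares of both sides agree.\<close>
  have "c * inv_sqrt_series = 1 + ?X + 2 * ?X ^ 2 * S"
  proof (rule fps_square_eq_imp_eq)
    have "(1 - 2 * ?X) ^ 2 * (1 + ?X + 2 * ?X ^ 2 * S) ^ 2 = R ^ 2"
      using S by algebra
    also have "\<dots> = (1 - 2 * ?X) ^ 2 * (c * inv_sqrt_series) ^ 2"
      using R2 c2 inv_sqrt_series_square by algebra
    finally show "(c * inv_sqrt_series) ^ 2 = (1 + ?X + 2 * ?X ^ 2 * S) ^ 2"
      using inv_sqrt_series_square by algebra
  qed (simp_all add: c0 inv_sqrt_series_def central_ratio_0)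
  \<comment> \<open>The summand 1 + x does not reach degree n + 2.\<close>
  then have S_nth: "2 * S $ n = (c * inv_sqrt_series) $ (n + 2)" for n
    by (simp add: numeral_fps_const fps_X_power_mult_nth mult.assoc mult.left_commute[of "fps_const 2"])
  have cd_nth: "(c * inv_sqrt_series) $ n = 2 ^ n * (\<Sum>k\<le>n. c $ k * (1 / 2) ^ k * central_ratio (n - k))" for n
    unfolding fps_mult_nth sum_distrib_left atLeast0AtMost
    by (intro sum.cong refl) (simp add: inv_sqrt_series_def power_diff field_simps)
  have "(\<lambda>n. (\<Sum>k\<le>n. c $ k * (1 / 2) ^ k * central_ratio (n - k)) * sqrt (real n)) \<longlonglongrightarrow> 1 / sqrt pi"
    using convolution_asymptotic[OF summable_abs_sqrt_coeff_weighted[OF c2 c0]] suminf_sqrt_coeff[OF c2 c0] by simp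
  from LIMSEQ_ignore_initial_segment[OF this, of 2]
  have "(\<lambda>n. (c * inv_sqrt_series) $ (n + 2) / 2 ^ (n + 2) * sqrt (real (n + 2))) \<longlonglongrightarrow> 1 / sqrt pi"
    unfolding cd_nth by simp
  then have "(\<lambda>n. S $ n / 2 ^ (n + 1) * sqrt (real (n + 2))) \<longlonglongrightarrow> 1 / sqrt pi"
    by (simp only: S_nth [symmetric]) simp
  \<comment> \<open>This factor exchanges sqrt (n + 2) for sqrt (pi n).\<close>
  moreover have "(\<lambda>n. sqrt pi * sqrt (real n / real (n + 2))) \<longlonglongrightarrow> sqrt pi"
    by real_asymp (simp add: sqrt_def)
  ultimately have "(\<lambda>n. S $ n / 2 ^ (n + 1) * sqrt (real (n + 2)) * (sqrt pi * sqrt (real n / real (n + 2))))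
      \<longlonglongrightarrow> 1 / sqrt pi * sqrt pi"
    by (rule tendsto_mult)
  \<comment> \<open>The two sequences agree also at n = 0, where division by zero makes the new one
    0.\<close>
  then have "(\<lambda>n. S $ n / (2 ^ (n + 1) / sqrt (pi * real n))) \<longlonglongrightarrow> 1"
    by (simp add: real_sqrt_divide real_sqrt_mult mult_ac)
  then show "(\<lambda>n. fps_nth S n) \<sim>[at_top] (\<lambda>n. 2 ^ (n + 1) / sqrt (pi * real n))"
    by (rule asymp_equivI'_const[where c = 1, simplified])
qed

end
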